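(* Let $d$ and $m$ be positive integers, let $\{a^{(j)}_n\}_{n\geq0}$, $j=1,\dots,d$, be sequences with ordinary generating functions $A_j(x)=\sum_{n\geq0}a^{(j)}_nx^n$, and let $\nu_d$ be the differential operator of order $d-1$ defined by $\nu_d(f)=\frac{d^{d-1}}{dx^{d-1}}\big(x^{d-1}f\big)$. Then $$\sum_{n\geq0}x^n\sum_{\alpha_1+\cdots+\alpha_d=n}\binom{n}{\alpha_1,\dots,\alpha_d}^{-m}\prod_{j=1}^d a^{(j)}_{\alpha_j}=\nu_d^m\left[\int_V\cdots\int_V\ \prod_{j=1}^d A_j\big(x\,x_{j,1}x_{j,2}\cdots x_{j,m}\big)\ \prod_{s=1}^m d\sigma(x_{1,s},\dots,x_{d,s})\right],$$ where there are $m$ integrals, the $s$-th one over the point $(x_{1,s},\dots,x_{d,s})\in V$.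
   Context: The inner sum runs over $d$-tuples of nonnegative integers $(\alpha_1,\dots,\alpha_d)$ with sum $n$, and $\binom{n}{\alpha_1,\dots,\alpha_d}=\frac{n!}{\alpha_1!\cdots\alpha_d!}$ is the multinomial coefficient. $V=\{(y_1,\dots,y_d): y_i\geq0,\ y_1+\cdots+y_d=1\}$ is the standard simplex, and $d\sigma(y_1,\dots,y_d)=dy_1\cdots dy_{d-1}$ denotes integration over $V$ parametrized by its first $d-1$ coordinates (with $y_d=1-y_1-\cdots-y_{d-1}$). The identity is between power series in $x$, the integral being taken term by term. *)

theory Defs
  imports "HOL-Analysis.Analysis" "HOL-Computational_Algebra.Formal_Power_Series"
begin

definition multinomial :: "nat \<Rightarrow> nat \<Rightarrow> (nat \<Rightarrow> nat) \<Rightarrow> 'a::field_char_0" where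
  "multinomial d n \<alpha> = fact n / (\<Prod>j\<in>{1..d}. fact (\<alpha> j))"

text \<open>\<open>d\<close>-tuples are represented by extensional functions on \<open>{1..d}\<close>, so that each tuple
  is represented exactly once.\<close>

definition compositions :: "nat \<Rightarrow> nat \<Rightarrow> (nat \<Rightarrow> nat) set" where
  "compositions d n = {\<alpha> \<in> {1..d} \<rightarrow>\<^sub>E UNIV. (\<Sum>j\<in>{1..d}. \<alpha> j) = n}"

definition std_simplex :: "nat \<Rightarrow> (nat \<Rightarrow> real) set" where
  "std_simplex d = {y \<in> {1..d} \<rightarrow>\<^sub>E UNIV. (\<forall>i\<in>{1..d}. 0 \<le> y i) \<and> (\<Sum>i\<in>{1..d}. y i) = 1}"

definition simplex_param :: "nat \<Rightarrow> (nat \<Rightarrow> real) \<Rightarrow> (nat \<Rightarrow> real)" where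
  "simplex_param d y = (\<lambda>i\<in>{1..d}. if i < d then y i else 1 - (\<Sum>k\<in>{1..<d}. y k))"

text \<open>The measure \<open>dy\<^sub>1 \<dots> dy\<^bsub>d-1\<^esub>\<close> on the hyperplane \<open>y\<^sub>1 + \<dots> + y\<^sub>d = 1\<close>, which contains the
  standard simplex. For \<open>d = 1\<close> there is no integration variable, and this is the unit point
  mass at the single point \<open>y\<^sub>1 = 1\<close>.\<close>

definition simplex_sigma :: "nat \<Rightarrow> (nat \<Rightarrow> real) measure" where
  "simplex_sigma d =
     distr (Pi\<^sub>M {1..<d} (\<lambda>_. lborel)) (Pi\<^sub>M {1..d} (\<lambda>_. borel)) (simplex_param d)"

text \<open>The \<open>m\<close>-fold iterated integral over the standard simplex of a function of \<open>m\<close> points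
  \<open>X 1, \<dots>, X m\<close>; here \<open>X s j\<close> is the \<open>j\<close>-th coordinate of the \<open>s\<close>-th point. The value \<open>0\<close> in
  the base case is a dummy for the points \<open>X s\<close> with \<open>s\<close> outside \<open>{1..m}\<close>.\<close>

primrec simplex_integrals ::
  "nat \<Rightarrow> nat \<Rightarrow> ((nat \<Rightarrow> nat \<Rightarrow> real) \<Rightarrow> 'a::{banach, second_countable_topology}) \<Rightarrow> 'a" where
  "simplex_integrals d 0 F = F (\<lambda>s j. 0)"
| "simplex_integrals d (Suc m) F =
     (LINT y:std_simplex d|simplex_sigma d. simplex_integrals d m (\<lambda>X. F (X(Suc m := y))))"

definition fps_simplex_integrals ::
  "nat \<Rightarrow> nat \<Rightarrow> ((nat \<Rightarrow> nat \<Rightarrow> real) \<Rightarrow> 'a::{banach, second_countable_topology} fps) \<Rightarrow> 'a fps"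
  where
  "fps_simplex_integrals d m F = Abs_fps (\<lambda>n. simplex_integrals d m (\<lambda>X. fps_nth (F X) n))"

definition fps_dilate :: "'a::real_normed_field fps \<Rightarrow> real \<Rightarrow> 'a fps" where
  "fps_dilate A c = A oo (fps_const (of_real c) * fps_X)"

definition nu :: "nat \<Rightarrow> 'a::comm_ring_1 fps \<Rightarrow> 'a fps" where
  "nu d f = (fps_deriv ^^ (d - 1)) (fps_X ^ (d - 1) * f)"

end

theory Submission imports Defs begin

text \<open>In the coefficient of \<open>x\<^sup>n\<close> the integrand splits into monomials indexed by the compositions
  \<open>\<alpha>\<close> of \<open>n\<close>. Each of the \<open>m\<close> integrals contributes Dirichlet's integral
  \<open>\<alpha>\<^sub>1! \<dots> \<alpha>\<^sub>d! / (n + d - 1)!\<close>, and each application of \<open>\<nu>\<^sub>d\<close> contributes the factor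
  \<open>(n + d - 1)! / n!\<close>; their product is the inverse of the multinomial coefficient.\<close>

section \<open>Dirichlet's integral\<close>

text \<open>Euler's Beta integral B(p+1, q+1), rescaled to an interval of length \<open>t\<close>.
  Integration by parts trades a power of \<open>y\<close> for a power of \<open>t - y\<close>, so
  the induction on \<open>p\<close> needs \<open>q\<close> arbitrary.\<close>

lemma has_integral_beta_nat:
  fixes t :: real
  assumes "0 \<le> t"
  shows "((\<lambda>y. y ^ p * (t - y) ^ q) has_integral
           t ^ (p + q + 1) * fact p * fact q / fact (p + q + 1)) {0..t}"
proof (induction p arbitrary: q)
  case 0
  have "((\<lambda>y. (t - y) ^ q) has_integral
      (- ((t - t) ^ Suc q / of_nat (Suc q))) - (- ((t - 0) ^ Suc q / of_nat (Suc q)))) {0..t}"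
    using assms
    by (intro fundamental_theorem_of_calculus)
       (auto intro!: derivative_eq_intros
          simp del: of_nat_Suc power_Suc simp flip: has_real_derivative_iff_has_vector_derivative)
  also have "(- ((t - t) ^ Suc q / of_nat (Suc q))) - (- ((t - 0) ^ Suc q / of_nat (Suc q)))
      = t ^ (0 + q + 1) * fact 0 * fact q / fact (0 + q + 1)"
    by (simp del: of_nat_Suc)
  finally show ?case
    by simp
next
  case (Suc p)
  \<comment> \<open>The integrand is the derivative of
    \<open>- (y ^ Suc p * (t - y) ^ Suc q)\<close>, which vanishes at both endpoints; hence its two
    terms have equal integrals, and the second is covered by the induction hypothesis at
    \<open>Suc q\<close>.\<close>
  have "((\<lambda>y. (1 + real q) * (y ^ Suc p * (t - y) ^ q) - (1 + real p) * (y ^ p * (t - y) ^ Suc q))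
      has_integral (- (t ^ Suc p * (t - t) ^ Suc q)) - (- (0 ^ Suc p * (t - 0) ^ Suc q))) {0..t}"
    using assms
    by (intro fundamental_theorem_of_calculus)
       (auto intro!: derivative_eq_intros
          simp: algebra_simps simp del: power_Suc simp flip: has_real_derivative_iff_has_vector_derivative)
  from has_integral_add[OF this has_integral_mult_right[OF Suc.IH[of "Suc q"], of "1 + real p"]]
  have "((\<lambda>y. (1 + real q) * (y ^ Suc p * (t - y) ^ q)) has_integral
      (1 + real p) * (t ^ (p + Suc q + 1) * fact p * fact (Suc q) / fact (p + Suc q + 1))) {0..t}"
    by simp
  from has_integral_mult_right[OF this, of "1 / (1 + real q)"]
  have "((\<lambda>y. y ^ Suc p * (t - y) ^ q) has_integral 1 / (1 + real q) *
      ((1 + real p) * (t ^ (p + Suc q + 1) * fact p * fact (Suc q) / fact (p + Suc q + 1)))) {0..t}"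
    by (simp del: power_Suc)
  also have "1 / (1 + real q) *
      ((1 + real p) * (t ^ (p + Suc q + 1) * fact p * fact (Suc q) / fact (p + Suc q + 1)))
      = t ^ (Suc p + q + 1) * fact (Suc p) * fact q / fact (Suc p + q + 1)"
    by (simp add: fact_Suc[of p] fact_Suc[of q] del: fact_Suc power_Suc)
  finally show ?case .
qed

text \<open>The factor with exponent \<open>b\<close> stands for the dependent last coordinate of
  the simplex. Coordinates are integrated out one at a time: slicing at \<open>z\<close> leaves a
  simplex of size \<open>t - z\<close>, so \<open>t\<close> has to vary in the induction. Working
  with nonnegative integrals allows Tonelli without prior integrability.\<close>

lemma nn_integral_dirichlet:
  fixes t :: real
  assumes "finite I" "0 \<le> t"
  shows "(\<integral>\<^sup>+y. ennreal (indicator {y. (\<forall>i\<in>I. 0 \<le> y i) \<and> (\<Sum>i\<in>I. y i) \<le> t} y *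
             ((\<Prod>i\<in>I. y i ^ \<alpha> i) * (t - (\<Sum>i\<in>I. y i)) ^ b)) \<partial>Pi\<^sub>M I (\<lambda>_. lborel))
         = ennreal (t ^ (card I + (\<Sum>i\<in>I. \<alpha> i) + b) * ((\<Prod>i\<in>I. fact (\<alpha> i)) * fact b)
             / fact (card I + (\<Sum>i\<in>I. \<alpha> i) + b))"
  using assms
proof (induction I arbitrary: t rule: finite_induct)
  case empty
  interpret product_sigma_finite "\<lambda>_::'a. lborel :: real measure" by standard
  show ?case
    using empty by (subst nn_integral_empty) auto
next
  case (insert i I)
  interpret product_sigma_finite "\<lambda>_::'a. lborel :: real measure" by standard
  \<comment> \<open>By the induction hypothesis, the integral over the remaining coordinates in a
    simplex of size \<open>t - z\<close> is \<open>C * (t - z) ^ N\<close>.\<close>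
  define N where "N = card I + (\<Sum>j\<in>I. \<alpha> j) + b"
  define C :: real where "C = (\<Prod>j\<in>I. fact (\<alpha> j)) * fact b / fact N"
  let ?g = "\<lambda>J t y. indicator {y. (\<forall>i\<in>J. 0 \<le> y i) \<and> (\<Sum>i\<in>J. y i) \<le> t} y *
             ((\<Prod>i\<in>J. y i ^ \<alpha> i) * (t - (\<Sum>i\<in>J. y i)) ^ b) :: real"
  have [simp]: "finite I" "i \<notin> I" by fact+
  have upd: "?g (insert i I) t (y(i := z)) = indicator {0..t} z * z ^ \<alpha> i * ?g I (t - z) y" for y z
  proof -
    have "(\<Sum>j\<in>I. (y(i := z)) j) = (\<Sum>j\<in>I. y j)"
      "(\<Prod>j\<in>I. (y(i := z)) j ^ \<alpha> j) = (\<Prod>j\<in>I. y j ^ \<alpha> j)"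
      by (auto intro!: sum.cong prod.cong)
    then have sum: "(\<Sum>j\<in>insert i I. (y(i := z)) j) = z + (\<Sum>j\<in>I. y j)"
      and prod: "(\<Prod>j\<in>insert i I. (y(i := z)) j ^ \<alpha> j) = z ^ \<alpha> i * (\<Prod>j\<in>I. y j ^ \<alpha> j)"
      by simp_all
    have nonneg: "(\<forall>j\<in>insert i I. 0 \<le> (y(i := z)) j) \<longleftrightarrow> 0 \<le> z \<and> (\<forall>j\<in>I. 0 \<le> y j)"
      by (simp add: fun_upd_def) (use \<open>i \<notin> I\<close> in blast)
    \<comment> \<open>The range \<open>{0..t}\<close> for the split-off coordinate is implicit: the
      other coordinates are nonnegative, so their sum only tightens the bound on
      \<open>z\<close>.\<close>
    have "z \<le> t" if "\<forall>j\<in>I. 0 \<le> y j" "z + (\<Sum>j\<in>I. y j) \<le> t"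
    proof -
      have "0 \<le> (\<Sum>j\<in>I. y j)"
        using that(1) by (simp add: sum_nonneg)
      with that(2) show ?thesis by linarith
    qed
    then have "(0 \<le> z \<and> (\<forall>j\<in>I. 0 \<le> y j)) \<and> z + (\<Sum>j\<in>I. y j) \<le> t \<longleftrightarrow>
        z \<in> {0..t} \<and> (\<forall>j\<in>I. 0 \<le> y j) \<and> (\<Sum>j\<in>I. y j) \<le> t - z"
      by auto
    then show ?thesis
      unfolding indicator_def mem_Collect_eq sum prod nonneg by (simp add: diff_diff_eq del: sum.insert prod.insert)
  qed
  have meas: "(\<lambda>y. ennreal (?g (insert i I) t y)) \<in> borel_measurable (Pi\<^sub>M (insert i I) (\<lambda>_. lborel))"
    by measurable
  have meas': "(\<lambda>y. ennreal (?g I s y)) \<in> borel_measurable (Pi\<^sub>M I (\<lambda>_. lborel))" for s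
    by measurable
  have "(\<integral>\<^sup>+y. ennreal (?g (insert i I) t y) \<partial>Pi\<^sub>M (insert i I) (\<lambda>_. lborel))
      = (\<integral>\<^sup>+z. \<integral>\<^sup>+y. ennreal (?g (insert i I) t (y(i := z))) \<partial>Pi\<^sub>M I (\<lambda>_. lborel) \<partial>lborel)"
    by (rule product_nn_integral_insert_rev[OF _ _ meas]) auto
  also have "\<dots> = (\<integral>\<^sup>+z. ennreal (C * (z ^ \<alpha> i * (t - z) ^ N)) * indicator {0..t} z \<partial>lborel)"
  proof (rule nn_integral_cong)
    fix z :: real
    show "(\<integral>\<^sup>+y. ennreal (?g (insert i I) t (y(i := z))) \<partial>Pi\<^sub>M I (\<lambda>_. lborel))
        = ennreal (C * (z ^ \<alpha> i * (t - z) ^ N)) * indicator {0..t} z"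
    proof (cases "z \<in> {0..t}")
      case False
      then show ?thesis by (simp only: upd) simp
    next
      case True
      then have "(\<integral>\<^sup>+y. ennreal (?g (insert i I) t (y(i := z))) \<partial>Pi\<^sub>M I (\<lambda>_. lborel))
          = (\<integral>\<^sup>+y. ennreal (z ^ \<alpha> i) * ennreal (?g I (t - z) y) \<partial>Pi\<^sub>M I (\<lambda>_. lborel))"
        by (simp only: upd) (simp add: ennreal_mult')
      also have "\<dots> = ennreal (z ^ \<alpha> i) * (\<integral>\<^sup>+y. ennreal (?g I (t - z) y) \<partial>Pi\<^sub>M I (\<lambda>_. lborel))"
        by (rule nn_integral_cmult[OF meas'])
      also have "\<dots> = ennreal (z ^ \<alpha> i) * ennreal (C * (t - z) ^ N)"
        using True by (subst insert.IH) (auto simp: C_def N_def mult_ac)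
      also have "\<dots> = ennreal (C * (z ^ \<alpha> i * (t - z) ^ N))"
        using True by (simp add: ennreal_mult'[symmetric] mult_ac)
      finally show ?thesis
        using True by simp
    qed
  qed
  \<comment> \<open>What remains is a Beta integral with exponents \<open>\<alpha> i\<close> and
    \<open>N\<close>; its \<open>fact N\<close> cancels the denominator of \<open>C\<close>.\<close>
  also have "\<dots> = ennreal (C * (t ^ (\<alpha> i + N + 1) * fact (\<alpha> i) * fact N / fact (\<alpha> i + N + 1)))"
    by (intro nn_integral_has_integral_lebesgue' has_integral_mult_right has_integral_beta_nat insert.prems)
       (auto simp: C_def intro!: mult_nonneg_nonneg divide_nonneg_nonneg prod_nonneg)
  also have "\<alpha> i + N + 1 = card (insert i I) + (\<Sum>j\<in>insert i I. \<alpha> j) + b"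
    by (simp add: N_def)
  finally show ?case
    by (simp add: C_def mult_ac)
qed

section \<open>Integration over the standard simplex\<close>

abbreviation monomial :: "nat \<Rightarrow> (nat \<Rightarrow> nat) \<Rightarrow> (nat \<Rightarrow> real) \<Rightarrow> real" where
  "monomial d \<alpha> y \<equiv> \<Prod>j\<in>{1..d}. y j ^ \<alpha> j"

text \<open>This is Dirichlet's integral with \<open>t = 1\<close> in the \<open>d - 1\<close> free
  coordinates, the exponent \<open>b\<close> being \<open>\<alpha> d\<close>. Integrability is
  recorded along with the value because the integral is later distributed over finite sums.\<close>

lemma has_bochner_integral_simplex_monomial:
  assumes "0 < d"
  shows "has_bochner_integral (simplex_sigma d) (\<lambda>y. indicator (std_simplex d) y * monomial d \<alpha> y)
           ((\<Prod>j\<in>{1..d}. fact (\<alpha> j)) / fact ((\<Sum>j\<in>{1..d}. \<alpha> j) + d - 1))"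
proof -
  let ?P = "Pi\<^sub>M {1..<d} (\<lambda>_. lborel) :: (nat \<Rightarrow> real) measure"
  let ?B = "Pi\<^sub>M {1..d} (\<lambda>_. borel) :: (nat \<Rightarrow> real) measure"
  let ?f = "\<lambda>y. indicator (std_simplex d) y * monomial d \<alpha> y"
  let ?S = "{y. (\<forall>i\<in>{1..<d}. 0 \<le> y i) \<and> (\<Sum>i\<in>{1..<d}. y i) \<le> (1::real)}"
  have ins: "{1..d} = insert d {1..<d}"
    using assms by auto
  have param: "simplex_param d \<in> ?P \<rightarrow>\<^sub>M ?B"
    unfolding simplex_param_def
  proof (rule measurable_restrict)
    fix i assume i: "i \<in> {1..d}"
    show "(\<lambda>y. if i < d then y i else 1 - (\<Sum>k\<in>{1..<d}. y k)) \<in> borel_measurable ?P"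
      using i by (cases "i < d") auto
  qed
  have "std_simplex d = {y \<in> space ?B. (\<forall>i\<in>{1..d}. 0 \<le> y i) \<and> (\<Sum>i\<in>{1..d}. y i) = 1}"
    by (auto simp: std_simplex_def space_PiM)
  also have "\<dots> \<in> sets ?B"
    by measurable
  finally have [measurable]: "std_simplex d \<in> sets ?B" .
  have f: "?f \<in> borel_measurable ?B"
    by measurable
  \<comment> \<open>Under the parametrization, nonnegativity of the last coordinate turns into the
    bound \<open>(\<Sum>i\<in>{1..<d}. y i) \<le> 1\<close>, while the condition that all
    coordinates sum to 1 holds automatically.\<close>
  have f_param: "?f (simplex_param d y)
      = indicator ?S y * ((\<Prod>i\<in>{1..<d}. y i ^ \<alpha> i) * (1 - (\<Sum>i\<in>{1..<d}. y i)) ^ \<alpha> d)" for y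
  proof -
    let ?y = "simplex_param d y"
    have last: "?y d = 1 - (\<Sum>i\<in>{1..<d}. y i)" and init: "\<And>i. i \<in> {1..<d} \<Longrightarrow> ?y i = y i"
      using assms by (auto simp: simplex_param_def)
    have "(\<Sum>i\<in>{1..d}. ?y i) = 1"
      using sum.cong[OF refl init, where A = "{1..<d}"] by (simp add: ins last del: One_nat_def)
    moreover have "?y \<in> {1..d} \<rightarrow>\<^sub>E UNIV"
      by (auto simp: simplex_param_def)
    ultimately have "?y \<in> std_simplex d \<longleftrightarrow> y \<in> ?S"
      using init by (auto simp: std_simplex_def ins last simp del: One_nat_def)
    moreover have "monomial d \<alpha> ?y = (\<Prod>i\<in>{1..<d}. y i ^ \<alpha> i) * (1 - (\<Sum>i\<in>{1..<d}. y i)) ^ \<alpha> d"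
      using init by (simp add: ins last mult.commute del: One_nat_def)
    ultimately show ?thesis
      by (simp add: indicator_def)
  qed
  have "has_bochner_integral ?P (\<lambda>y. ?f (simplex_param d y))
          ((\<Prod>j\<in>{1..d}. fact (\<alpha> j)) / fact ((\<Sum>j\<in>{1..d}. \<alpha> j) + d - 1))"
  proof (rule has_bochner_integral_nn_integral)
    show "(\<lambda>y. ?f (simplex_param d y)) \<in> borel_measurable ?P"
      using param f by (rule measurable_compose)
    show "AE y in ?P. 0 \<le> ?f (simplex_param d y)"
      by (auto simp: indicator_def std_simplex_def intro!: prod_nonneg)
    show "(\<integral>\<^sup>+y. ennreal (?f (simplex_param d y)) \<partial>?P)
        = ennreal ((\<Prod>j\<in>{1..d}. fact (\<alpha> j)) / fact ((\<Sum>j\<in>{1..d}. \<alpha> j) + d - 1))"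
      unfolding f_param using assms
      by (subst nn_integral_dirichlet) (auto simp: ins algebra_simps simp del: One_nat_def)
  qed (auto intro!: divide_nonneg_nonneg prod_nonneg)
  then show ?thesis
    using param f
    by (simp add: simplex_sigma_def has_bochner_integral_iff integrable_distr_eq integral_distr)
qed

text \<open>The integrand separates over the \<open>m\<close> points, so each integration
  contributes one Dirichlet factor per term. The coefficients \<open>c\<close> are arbitrary because
  they absorb the monomial of the point held fixed by the outermost integral.\<close>

lemma simplex_integrals_sum_monomial:
  fixes c :: "(nat \<Rightarrow> nat) \<Rightarrow> 'a::{real_normed_field, banach, second_countable_topology}"
  assumes "0 < d"
  shows "simplex_integrals d m (\<lambda>X. \<Sum>\<alpha>\<in>S. c \<alpha> * of_real (\<Prod>s\<in>{1..m}. monomial d \<alpha> (X s)))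
       = (\<Sum>\<alpha>\<in>S. c \<alpha> * of_real
            ((\<Prod>j\<in>{1..d}. fact (\<alpha> j)) / fact ((\<Sum>j\<in>{1..d}. \<alpha> j) + d - 1)) ^ m)"
proof (induction m arbitrary: c)
  case 0
  show ?case by simp
next
  case (Suc m)
  let ?D = "\<lambda>\<alpha>. (\<Prod>j\<in>{1..d}. fact (\<alpha> j)) / fact ((\<Sum>j\<in>{1..d}. \<alpha> j) + d - 1) :: real"
  have upd: "(\<Prod>s\<in>{1..Suc m}. monomial d \<alpha> ((X(Suc m := y)) s))
      = monomial d \<alpha> y * (\<Prod>s\<in>{1..m}. monomial d \<alpha> (X s))" for \<alpha> X y
  proof -
    have "(\<Prod>s\<in>{1..m}. monomial d \<alpha> ((X(Suc m := y)) s)) = (\<Prod>s\<in>{1..m}. monomial d \<alpha> (X s))"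
      by (intro prod.cong) auto
    then show ?thesis
      by (simp add: mult.commute)
  qed
  have "simplex_integrals d (Suc m)
          (\<lambda>X. \<Sum>\<alpha>\<in>S. c \<alpha> * of_real (\<Prod>s\<in>{1..Suc m}. monomial d \<alpha> (X s)))
      = (LINT y:std_simplex d|simplex_sigma d. simplex_integrals d m
          (\<lambda>X. \<Sum>\<alpha>\<in>S. (c \<alpha> * of_real (monomial d \<alpha> y)) * of_real (\<Prod>s\<in>{1..m}. monomial d \<alpha> (X s))))"
    unfolding simplex_integrals.simps upd of_real_mult mult.assoc ..
  \<comment> \<open>After the inner integrals are evaluated, \<open>y\<close> occurs only through
    its monomial, and the outer integral can be taken term by term.\<close>
  also have "\<dots> = (LINT y|simplex_sigma d. (\<Sum>\<alpha>\<in>S.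
      of_real (indicator (std_simplex d) y * monomial d \<alpha> y) * (c \<alpha> * of_real (?D \<alpha>) ^ m)))"
    unfolding Suc.IH set_lebesgue_integral_def
    by (intro Bochner_Integration.integral_cong refl)
       (simp add: scaleR_conv_of_real sum_distrib_left mult_ac)
  also have "\<dots> = (\<Sum>\<alpha>\<in>S. of_real (?D \<alpha>) * (c \<alpha> * of_real (?D \<alpha>) ^ m))"
    using assms
    by (intro has_bochner_integral_integral_eq has_bochner_integral_sum has_bochner_integral_mult_left
          has_bochner_integral_of_real has_bochner_integral_simplex_monomial)
  finally show ?case
    by (simp add: mult_ac)
qed

section \<open>Coefficients\<close>

unbundle no vec_syntax and fps_syntax

lemma count_sum_replicate_mset:
  "finite I \<Longrightarrow> count (\<Sum>j\<in>I. replicate_mset (\<alpha> j) j) k = (if k \<in> I then \<alpha> k else 0)"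
  by (simp add: count_sum)

text \<open>The known product formula sums over multisets of size \<open>n\<close> on the index set.
  Such a multiset is determined by its multiplicities, which form a composition of \<open>n\<close>;
  restricting the count function to \<open>{1..d}\<close> gives the extensional
  representative.\<close>

lemma fps_nth_prod_compositions:
  fixes f :: "nat \<Rightarrow> 'a::comm_semiring_1 fps"
  shows "(\<Prod>j\<in>{1..d}. f j) $ n = (\<Sum>\<alpha>\<in>compositions d n. \<Prod>j\<in>{1..d}. f j $ \<alpha> j)"
  unfolding fps_prod_nth'[OF finite_atLeastAtMost]
proof (rule sum.reindex_bij_witness[where
      i = "\<lambda>\<alpha>. \<Sum>j\<in>{1..d}. replicate_mset (\<alpha> j) j" and j = "\<lambda>X. restrict (count X) {1..d}"])
  fix X assume X: "X \<in> multisets_of_size {1..d} n"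
  then have sub: "set_mset X \<subseteq> {1..d}" and size: "size X = n"
    by (auto simp: multisets_of_size_def)
  show "(\<Sum>j\<in>{1..d}. replicate_mset (restrict (count X) {1..d} j) j) = X"
  proof (rule multiset_eqI)
    fix k
    show "count (\<Sum>j\<in>{1..d}. replicate_mset (restrict (count X) {1..d} j) j) k = count X k"
      unfolding count_sum_replicate_mset[OF finite_atLeastAtMost] using sub by (auto simp: not_in_iff[symmetric] simp del: One_nat_def)
  qed
  have "(\<Sum>j\<in>{1..d}. count X j) = size X"
    unfolding size_multiset_overloaded_eq using sub
    by (intro sum.mono_neutral_right) (auto simp: not_in_iff)
  then show "restrict (count X) {1..d} \<in> compositions d n"
    by (simp add: compositions_def size)
  show "(\<Prod>j\<in>{1..d}. f j $ restrict (count X) {1..d} j) = (\<Prod>j\<in>{1..d}. f j $ count X j)"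
    by simp
next
  fix \<alpha> assume "\<alpha> \<in> compositions d n"
  then have \<alpha>: "\<alpha> \<in> {1..d} \<rightarrow>\<^sub>E UNIV" "(\<Sum>j\<in>{1..d}. \<alpha> j) = n"
    by (auto simp: compositions_def)
  show "restrict (count (\<Sum>j\<in>{1..d}. replicate_mset (\<alpha> j) j)) {1..d} = \<alpha>"
    using \<alpha>(1) by (auto simp: fun_eq_iff restrict_def count_sum_replicate_mset PiE_def extensional_def
        simp del: atLeastAtMost_iff One_nat_def)
  show "(\<Sum>j\<in>{1..d}. replicate_mset (\<alpha> j) j) \<in> multisets_of_size {1..d} n"
    using \<alpha>(2) by (auto simp: multisets_of_size_def size_multiset_sum set_mset_sum)
qed

section \<open>Derivatives and the operator \<open>nu\<close>\<close>

lemma fps_nth_higher_deriv: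
  fixes f :: "'a::field_char_0 fps"
  shows "(fps_deriv ^^ k) f $ n = fact (n + k) / fact n * f $ (n + k)"
proof (induction k arbitrary: n)
  case 0
  show ?case by simp
next
  case (Suc k)
  \<comment> \<open>The outermost derivative moves the index to \<open>Suc n\<close>, and its factor
    \<open>Suc n\<close> reduces the denominator \<open>fact (Suc n)\<close> to
    \<open>fact n\<close>.\<close>
  have "(fps_deriv ^^ Suc k) f $ n = of_nat (Suc n) * (fact (Suc n + k) / fact (Suc n) * f $ (Suc n + k))"
    using Suc.IH[of "Suc n"] by simp
  also have "\<dots> = fact (Suc n + k) / fact n * f $ (Suc n + k)"
    by (simp del: of_nat_Suc)
  finally show ?case by simp
qed

text \<open>Multiplication by \<open>fps_X ^ (d - 1)\<close> shifts coefficients up by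
  \<open>d - 1\<close> and the derivatives shift them back, so \<open>nu d\<close> acts diagonally
  on coefficients.\<close>

lemma fps_nth_nu:
  fixes f :: "'a::field_char_0 fps"
  assumes "0 < d"
  shows "nu d f $ n = fact (n + d - 1) / fact n * f $ n"
  using assms by (simp add: nu_def fps_nth_higher_deriv fps_X_power_mult_nth)

lemma fps_nth_nu_funpow:
  fixes f :: "'a::field_char_0 fps"
  assumes "0 < d"
  shows "(nu d ^^ m) f $ n = (fact (n + d - 1) / fact n) ^ m * f $ n"
  by (induction m) (simp_all add: fps_nth_nu[OF assms] mult_ac)

section \<open>Coefficients of the integrand and the identity\<close>

lemma fps_nth_dilate: "fps_dilate A c $ n = of_real c ^ n * A $ n"
  unfolding fps_dilate_def by (rule fps_nth_compose_linear)

text \<open>Exchanging the products over \<open>j\<close> and \<open>s\<close> regroups the powers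
  by points, which separates the variables of the \<open>m\<close> integrals.\<close>

lemma fps_nth_prod_dilate:
  fixes A :: "nat \<Rightarrow> 'a::real_normed_field fps"
  shows "(\<Prod>j\<in>{1..d}. fps_dilate (A j) (\<Prod>s\<in>{1..m}. X s j)) $ n
       = (\<Sum>\<alpha>\<in>compositions d n. (\<Prod>j\<in>{1..d}. A j $ \<alpha> j) *
            of_real (\<Prod>s\<in>{1..m}. monomial d \<alpha> (X s)))"
proof -
  have "(\<Prod>s\<in>{1..m}. monomial d \<alpha> (X s)) = (\<Prod>j\<in>{1..d}. (\<Prod>s\<in>{1..m}. X s j) ^ \<alpha> j)" for \<alpha>
    by (subst prod.swap) (simp add: prod_power_distrib)
  then show ?thesis
    unfolding fps_nth_prod_compositions
    by (simp add: fps_nth_dilate prod.distrib mult.commute)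
qed

theorem theorem4:
  fixes d m :: nat
    and a :: "nat \<Rightarrow> nat \<Rightarrow> 'a::{real_normed_field, banach, second_countable_topology}"
    and A :: "nat \<Rightarrow> 'a fps"
  assumes "0 < d" and "0 < m"
    and "\<And>j. j \<in> {1..d} \<Longrightarrow> A j = Abs_fps (a j)"
  shows "Abs_fps (\<lambda>n. \<Sum>\<alpha>\<in>compositions d n.
             inverse (multinomial d n \<alpha>) ^ m * (\<Prod>j\<in>{1..d}. a j (\<alpha> j)))
         = (nu d ^^ m) (fps_simplex_integrals d m
             (\<lambda>X. \<Prod>j\<in>{1..d}. fps_dilate (A j) (\<Prod>s\<in>{1..m}. X s j)))"
proof (rule fps_ext)
  fix n
  \<comment> \<open>Since \<open>nu d\<close> is diagonal and the integrals are taken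
    coefficientwise, both sides can be compared at a single \<open>n\<close>.\<close>
  have "(nu d ^^ m) (fps_simplex_integrals d m
             (\<lambda>X. \<Prod>j\<in>{1..d}. fps_dilate (A j) (\<Prod>s\<in>{1..m}. X s j))) $ n
      = (\<Sum>\<alpha>\<in>compositions d n. (fact (n + d - 1) / fact n) ^ m * ((\<Prod>j\<in>{1..d}. A j $ \<alpha> j) *
          of_real ((\<Prod>j\<in>{1..d}. fact (\<alpha> j)) / fact ((\<Sum>j\<in>{1..d}. \<alpha> j) + d - 1)) ^ m))"
    unfolding fps_nth_nu_funpow[OF assms(1)] fps_simplex_integrals_def fps_nth_Abs_fps
      fps_nth_prod_dilate simplex_integrals_sum_monomial[OF assms(1)] sum_distrib_left ..
  also have "\<dots> = (\<Sum>\<alpha>\<in>compositions d n.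
             inverse (multinomial d n \<alpha>) ^ m * (\<Prod>j\<in>{1..d}. a j (\<alpha> j)))"
  proof (rule sum.cong[OF refl])
    fix \<alpha> assume "\<alpha> \<in> compositions d n"
    then have "(\<Sum>j\<in>{1..d}. \<alpha> j) = n"
      by (simp add: compositions_def)
    moreover have "(\<Prod>j\<in>{1..d}. A j $ \<alpha> j) = (\<Prod>j\<in>{1..d}. a j (\<alpha> j))"
      by (intro prod.cong) (simp_all add: assms(3))
    ultimately show "(fact (n + d - 1) / fact n) ^ m * ((\<Prod>j\<in>{1..d}. A j $ \<alpha> j) *
          of_real ((\<Prod>j\<in>{1..d}. fact (\<alpha> j)) / fact ((\<Sum>j\<in>{1..d}. \<alpha> j) + d - 1)) ^ m)
        = inverse (multinomial d n \<alpha>) ^ m * (\<Prod>j\<in>{1..d}. a j (\<alpha> j))"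
      \<comment> \<open>With the entries of \<open>\<alpha>\<close> summing to \<open>n\<close>, the
        factors \<open>fact (n + d - 1)\<close> cancel, leaving the \<open>m\<close>-th power of
        \<open>(\<Prod>j\<in>{1..d}. fact (\<alpha> j)) / fact n\<close>.\<close>
      by (simp add: multinomial_def power_divide)
  qed
  finally show "Abs_fps (\<lambda>n. \<Sum>\<alpha>\<in>compositions d n.
             inverse (multinomial d n \<alpha>) ^ m * (\<Prod>j\<in>{1..d}. a j (\<alpha> j))) $ n
         = (nu d ^^ m) (fps_simplex_integrals d m
             (\<lambda>X. \<Prod>j\<in>{1..d}. fps_dilate (A j) (\<Prod>s\<in>{1..m}. X s j))) $ n"
    by simp
qed

end
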